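(* Let $p$ be a prime (possibly $2$), $q = p^m$, $\sigma = p^k$, and $a,b,c \in \mathbb{F}_q$. Define $F_1,F_2,F_3 \colon \mathbb{F}_q^3 \to \mathbb{F}_q$ by \begin{align*} F_1(x,y,z) &= x^{\sigma+1} + a y^{\sigma} z + b x^{\sigma} y + c x^{\sigma} z,\\ F_2(x,y,z) &= a y^{\sigma+1} + z^{\sigma} x + b z^{\sigma} y + c x^{\sigma} y,\\ F_3(x,y,z) &= z^{\sigma+1} - x^{\sigma} y, \end{align*} and let $F = (F_1,F_2,F_3)$. Then $F$ induces a bijection $\overline{F}$ of the projective plane $\mathbb{P}^2(\mathbb{F}_q)$ (that is, $F(\underline{x}) = 0$ only for $\underline{x} = 0$, and the induced map $\overline{F}$ on $\mathbb{P}^2(\mathbb{F}_q)$ is bijective) if and only if the equation \[ x^{\sigma^2+\sigma+1} + c x^{\sigma^2+\sigma} + b x^{\sigma^2} + a = 0 \] has no solution $x \in \mathbb{F}_q$.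
   Context: $\mathbb{P}^2(\mathbb{F}_q)$ is the set of classes of $\mathbb{F}_q^3\setminus\{0\}$ under $\underline{u} \sim \lambda\underline{u}$, $\lambda \in \mathbb{F}_q^\times$. The map $F$ satisfies $F(\lambda \underline{x}) = \lambda^{\sigma+1} F(\underline{x})$ for all $\lambda\in\mathbb{F}_q$, so if $F(\underline{x})=0$ holds only for $\underline{x}=0$, then $F$ induces a well-defined map $\overline{F} \colon \mathbb{P}^2(\mathbb{F}_q) \to \mathbb{P}^2(\mathbb{F}_q)$; only in this case is $\overline{F}$ defined. *)

theory Defs
  imports "HOL-Analysis.Cartesian_Space" "HOL-Computational_Algebra.Primes"
begin

definition proj_rel :: "(('a::field ^ 'n) \<times> ('a ^ 'n)) set" where
  "proj_rel = {(u, v). u \<noteq> 0 \<and> v \<noteq> 0 \<and> (\<exists>l. l \<noteq> 0 \<and> v = l *s u)}"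

definition proj_plane :: "('a::field ^ 3) set set" where
  "proj_plane = (UNIV - {0}) // proj_rel"

text \<open>The induced map is written as the union of the classes of \<open>G u\<close> over all representatives
  \<open>u\<close>. It is meaningful when \<open>G\<close> vanishes only at \<open>0\<close> and maps proportional vectors to
  proportional vectors; then it sends the class of \<open>u\<close> to the class of \<open>G u\<close>, see
  \<open>induced_map_class\<close>.\<close>

definition induced_map :: "('a::field ^ 'n \<Rightarrow> 'a ^ 'n) \<Rightarrow> ('a ^ 'n) set \<Rightarrow> ('a ^ 'n) set" where
  "induced_map G C = (\<Union>u\<in>C. proj_rel `` {G u})"

definition induces_proj_bijection :: "('a::field ^ 3 \<Rightarrow> 'a ^ 3) \<Rightarrow> bool" where
  "induces_proj_bijection G \<longleftrightarrow>
     (\<forall>u. G u = 0 \<longrightarrow> u = 0) \<and> bij_betw (induced_map G) proj_plane proj_plane"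

definition F1 :: "nat \<Rightarrow> 'a::field \<Rightarrow> 'a \<Rightarrow> 'a \<Rightarrow> 'a \<Rightarrow> 'a \<Rightarrow> 'a \<Rightarrow> 'a" where
  "F1 \<sigma> a b c x y z = x ^ (\<sigma> + 1) + a * y ^ \<sigma> * z + b * x ^ \<sigma> * y + c * x ^ \<sigma> * z"

definition F2 :: "nat \<Rightarrow> 'a::field \<Rightarrow> 'a \<Rightarrow> 'a \<Rightarrow> 'a \<Rightarrow> 'a \<Rightarrow> 'a \<Rightarrow> 'a" where
  "F2 \<sigma> a b c x y z = a * y ^ (\<sigma> + 1) + z ^ \<sigma> * x + b * z ^ \<sigma> * y + c * x ^ \<sigma> * y"

definition F3 :: "nat \<Rightarrow> 'a::field \<Rightarrow> 'a \<Rightarrow> 'a \<Rightarrow> 'a" where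
  "F3 \<sigma> x y z = z ^ (\<sigma> + 1) - x ^ \<sigma> * y"

definition F :: "nat \<Rightarrow> 'a::field \<Rightarrow> 'a \<Rightarrow> 'a \<Rightarrow> 'a ^ 3 \<Rightarrow> 'a ^ 3" where
  "F \<sigma> a b c u = vector [F1 \<sigma> a b c (u $ 1) (u $ 2) (u $ 3),
                        F2 \<sigma> a b c (u $ 1) (u $ 2) (u $ 3),
                        F3 \<sigma> (u $ 1) (u $ 2) (u $ 3)]"

lemma equiv_proj_rel: "equiv (UNIV - {0}) (proj_rel :: (('a::field ^ 'n) \<times> _) set)"
proof (rule equivI)
  show "proj_rel \<subseteq> (UNIV - {0 :: 'a ^ 'n}) \<times> (UNIV - {0})"
    by (auto simp: proj_rel_def)
  show "refl_on (UNIV - {0 :: 'a ^ 'n}) proj_rel"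
    unfolding refl_on_def proj_rel_def
    by (auto intro!: exI[of _ "1::'a"])
  show "sym (proj_rel :: (('a ^ 'n) \<times> _) set)"
  proof (rule symI)
    fix u v :: "'a ^ 'n" assume "(u, v) \<in> proj_rel"
    then obtain l where l: "u \<noteq> 0" "v \<noteq> 0" "l \<noteq> 0" "v = l *s u"
      by (auto simp: proj_rel_def)
    then have "u = inverse l *s v" by (simp add: vector_smult_assoc)
    with l show "(v, u) \<in> proj_rel"
      unfolding proj_rel_def using nonzero_imp_inverse_nonzero by blast
  qed
  show "trans (proj_rel :: (('a ^ 'n) \<times> _) set)"
  proof (rule transI)
    fix u v w :: "'a ^ 'n" assume "(u, v) \<in> proj_rel" "(v, w) \<in> proj_rel"
    then obtain l l' where l: "u \<noteq> 0" "w \<noteq> 0" "l \<noteq> 0" "v = l *s u" "l' \<noteq> 0" "w = l' *s v"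
      by (auto simp: proj_rel_def)
    then have "w = (l' * l) *s u" "l' * l \<noteq> 0" by (simp_all add: vector_smult_assoc)
    with l show "(u, w) \<in> proj_rel" unfolding proj_rel_def by blast
  qed
qed

lemma induced_map_class:
  fixes G :: "'a::field ^ 'n \<Rightarrow> 'a ^ 'n"
  assumes "\<And>v. G v = 0 \<Longrightarrow> v = 0"
    and hom: "\<And>l v. G (l *s v) = l ^ n *s G v"
    and "u \<noteq> 0"
  shows "induced_map G (proj_rel `` {u}) = proj_rel `` {G u}"
proof -
  have "proj_rel `` {G v} = proj_rel `` {G u}" if "v \<in> proj_rel `` {u}" for v
  proof -
    from that obtain l where l: "v = l *s u" "l \<noteq> 0" "v \<noteq> 0"
      by (auto simp: proj_rel_def)
    then have "G v = l ^ n *s G u" "l ^ n \<noteq> 0" using hom by auto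
    moreover have "G u \<noteq> 0" "G v \<noteq> 0" using assms(1) \<open>u \<noteq> 0\<close> \<open>v \<noteq> 0\<close> by blast+
    ultimately have "(G u, G v) \<in> proj_rel" unfolding proj_rel_def by blast
    then show ?thesis using equiv_class_eq[OF equiv_proj_rel] by blast
  qed
  moreover have "u \<in> proj_rel `` {u}"
    using equiv_class_self[OF equiv_proj_rel] \<open>u \<noteq> 0\<close> by blast
  ultimately show ?thesis unfolding induced_map_def by blast
qed

lemma F_scale: "F \<sigma> a b c (l *s u) = l ^ (\<sigma> + 1) *s F \<sigma> a b c u"
  by (simp add: F_def F1_def F2_def F3_def vec_eq_iff forall_3 power_mult_distrib algebra_simps)

end

theory Submission
  imports Defs "HOL-Number_Theory.Residues"
begin

text \<open>Put \<open>L\<^sub>1(u) = (y, -z, x + b y)\<close> and \<open>L\<^sub>2(u) = (z, -x, -(a y + c x))\<close>. Then \<open>F(u)\<close> is the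
  cross product of \<open>L\<^sub>1(u)\<close> and \<open>L\<^sub>2(u\<^sup>\<sigma>)\<close>, where \<open>u\<^sup>\<sigma>\<close> is taken coordinatewise.
  If \<open>a \<noteq> 0\<close>, a nontrivial zero of \<open>F\<close> has \<open>x \<noteq> 0\<close>, so up to scaling it is \<open>(1, z\<^sup>\<sigma>\<^sup>+\<^sup>1, z)\<close>, and
  \<open>1 / z\<close> is then a root of the polynomial; if \<open>a = 0\<close>, there are the root \<open>0\<close> and the zero \<open>(0, 1, 0)\<close>.
  If \<open>F\<close> has no nontrivial zero, then it is onto the projective plane: given \<open>v\<close>, the conditions
  \<open>L\<^sub>1(u) \<bullet> v = 0\<close> and \<open>L\<^sub>2(u\<^sup>\<sigma>) \<bullet> v = 0\<close> amount, after extracting \<open>\<sigma>\<close>-th roots in the second, to two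
  linear equations for the three coordinates of \<open>u\<close>. For a nonzero solution \<open>u\<close>,
  both \<open>v\<close> and \<open>F(u)\<close> are orthogonal to \<open>L\<^sub>1(u)\<close> and \<open>L\<^sub>2(u\<^sup>\<sigma>)\<close>, which are independent because
  \<open>F(u) \<noteq> 0\<close>. Hence \<open>v\<close> is proportional to \<open>F(u)\<close>, and finiteness gives bijectivity.\<close>

lemma prime_CHAR_of_CARD:
  assumes "prime p" and "CARD('a::{field,finite}) = p ^ m"
  shows "CHAR('a) = p"
proof -
  have "prime CHAR('a)"
    by (rule prime_CHAR_semidom) (simp add: finite_imp_CHAR_pos)
  moreover have "CHAR('a) dvd p ^ m"
    using CHAR_dvd_CARD[where 'a = 'a] assms(2) by simp
  ultimately show ?thesis
    using assms(1) prime_dvd_power primes_dvd_imp_eq by blast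
qed

text \<open>Additivity turns equal powers into a vanishing power of the difference, so the map is
  injective. This provides the \<sigma>-th roots.\<close>

lemma power_surj_if_additive:
  fixes n :: nat
  assumes "\<And>x y :: 'a::{idom,finite}. (x + y) ^ n = x ^ n + y ^ n"
  shows "surj (\<lambda>x::'a. x ^ n)"
proof -
  have "inj (\<lambda>x::'a. x ^ n)"
  proof (rule injI)
    fix x y :: 'a assume "x ^ n = y ^ n"
    then have "(x - y) ^ n = 0" using assms[of "x - y" y] by simp
    then show "x = y" by simp
  qed
  then show ?thesis by (simp add: finite_UNIV_inj_surj)
qed

text \<open>Padding the two equations with a zero row gives a singular square matrix, whose kernel
  contains the required vector.\<close>

lemma exists_common_orthogonal_3:
  fixes d1 d2 d3 e1 e2 e3 :: "'a::field"
  obtains x y z where "(x, y, z) \<noteq> (0, 0, 0)"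
    "d1 * x + d2 * y + d3 * z = 0" "e1 * x + e2 * y + e3 * z = 0"
proof -
  define A :: "'a ^ 3 ^ 3" where "A = vector [vector [d1, d2, d3], vector [e1, e2, e3], 0]"
  have "A ** B \<noteq> mat 1" for B
  proof
    assume "A ** B = mat 1"
    then have "(A ** B) $ 3 $ 3 = (mat 1 :: 'a ^ 3 ^ 3) $ 3 $ 3" by simp
    then show False by (simp add: A_def matrix_matrix_mult_def mat_def)
  qed
  then have "\<nexists>B. B ** A = mat 1" by (metis matrix_left_right_inverse)
  then obtain u where u: "A *v u = 0" "u \<noteq> 0" using matrix_left_invertible_ker[of A] by blast
  show thesis
  proof (rule that)
    show "(u $ 1, u $ 2, u $ 3) \<noteq> (0, 0, 0)" using u(2) by (auto simp: vec_eq_iff forall_3)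
    show "d1 * u $ 1 + d2 * u $ 2 + d3 * u $ 3 = 0" "e1 * u $ 1 + e2 * u $ 2 + e3 * u $ 3 = 0"
      using u(1) by (simp_all add: A_def vec_eq_iff forall_3 matrix_vector_mult_def sum_3)
  qed
qed

lemma proportional_if_cross_zero:
  fixes u v :: "'a::field ^ 3"
  assumes "u \<noteq> 0"
    and "u $ 2 * v $ 3 = u $ 3 * v $ 2" "u $ 3 * v $ 1 = u $ 1 * v $ 3" "u $ 1 * v $ 2 = u $ 2 * v $ 1"
  obtains l where "v = l *s u"
proof -
  from assms(1) consider "u $ 1 \<noteq> 0" | "u $ 2 \<noteq> 0" | "u $ 3 \<noteq> 0"
    by (auto simp: vec_eq_iff forall_3)
  then show thesis
  proof cases
    case 1
    then have "v = (v $ 1 / u $ 1) *s u"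
      using assms by (simp add: vec_eq_iff forall_3 field_simps)
    then show thesis by (rule that)
  next
    case 2
    then have "v = (v $ 2 / u $ 2) *s u"
      using assms by (simp add: vec_eq_iff forall_3 field_simps)
    then show thesis by (rule that)
  next
    case 3
    then have "v = (v $ 3 / u $ 3) *s u"
      using assms by (simp add: vec_eq_iff forall_3 field_simps)
    then show thesis by (rule that)
  qed
qed

text \<open>A surjective self-map of the finite projective plane is injective.\<close>

lemma induces_proj_bijection_if_onto:
  fixes G :: "'a::{field,finite} ^ 3 \<Rightarrow> 'a ^ 3"
  assumes zero: "\<And>u. G u = 0 \<Longrightarrow> u = 0"
    and hom: "\<And>l u. G (l *s u) = l ^ n *s G u"
    and onto: "\<And>v. v \<noteq> 0 \<Longrightarrow> \<exists>u l. u \<noteq> 0 \<and> v = l *s G u"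
  shows "induces_proj_bijection G"
proof -
  have plane: "proj_plane = (\<lambda>u :: 'a ^ 3. proj_rel `` {u}) ` (UNIV - {0})"
    by (auto simp: proj_plane_def quotient_def)
  have ind: "induced_map G (proj_rel `` {u}) = proj_rel `` {G u}" if "u \<noteq> 0" for u
    using induced_map_class[of G, OF zero hom that] .
  have "induced_map G ` proj_plane = (proj_plane :: ('a ^ 3) set set)"
  proof
    show "induced_map G ` proj_plane \<subseteq> proj_plane"
      using ind zero by (force simp: plane)
    show "proj_plane \<subseteq> induced_map G ` proj_plane"
    proof
      fix C :: "('a ^ 3) set" assume "C \<in> proj_plane"
      then obtain v where v: "v \<noteq> 0" "C = proj_rel `` {v}" by (auto simp: plane)
      obtain u l where u: "u \<noteq> 0" "v = l *s G u" using onto[OF v(1)] by blast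
      then have "(G u, v) \<in> proj_rel" using v(1) by (auto simp: proj_rel_def)
      then have "C = proj_rel `` {G u}"
        using equiv_class_eq[OF equiv_proj_rel] v(2) by blast
      then have "C = induced_map G (proj_rel `` {u})" using ind u(1) by simp
      then show "C \<in> induced_map G ` proj_plane" using u(1) by (auto simp: plane)
    qed
  qed
  moreover have "finite (proj_plane :: ('a ^ 3) set set)" by simp
  ultimately have "bij_betw (induced_map G) proj_plane proj_plane"
    by (metis bij_betw_def eq_card_imp_inj_on)
  then show ?thesis using zero by (simp add: induces_proj_bijection_def)
qed

lemma F_eq_0_iff:
  "F \<sigma> a b c u = 0 \<longleftrightarrow> F1 \<sigma> a b c (u $ 1) (u $ 2) (u $ 3) = 0 \<and>
     F2 \<sigma> a b c (u $ 1) (u $ 2) (u $ 3) = 0 \<and> F3 \<sigma> (u $ 1) (u $ 2) (u $ 3) = 0"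
  by (simp add: F_def vec_eq_iff forall_3)

abbreviation (input) has_root :: "nat \<Rightarrow> 'a::field \<Rightarrow> 'a \<Rightarrow> 'a \<Rightarrow> bool" where
  "has_root \<sigma> a b c \<equiv>
     \<exists>x. x ^ (\<sigma>\<^sup>2 + \<sigma> + 1) + c * x ^ (\<sigma>\<^sup>2 + \<sigma>) + b * x ^ (\<sigma>\<^sup>2) + a = 0"

lemma reciprocal_root:
  fixes z :: "'a::field"
  assumes "z \<noteq> 0"
  shows "(1 / z) ^ (\<sigma>\<^sup>2 + \<sigma> + 1) + c * (1 / z) ^ (\<sigma>\<^sup>2 + \<sigma>) + b * (1 / z) ^ (\<sigma>\<^sup>2) + a = 0 \<longleftrightarrow>
    1 + c * z + b * z ^ (\<sigma> + 1) + a * z ^ (\<sigma>\<^sup>2 + \<sigma> + 1) = 0"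
  using assms by (simp add: power_add power_divide divide_simps) (simp add: algebra_simps)

text \<open>For \<open>x = 1\<close>, the vanishing of \<open>F3\<close> means
  \<open>y = z ^ (\<sigma> + 1)\<close>. On this curve \<open>F1\<close> and \<open>F2\<close> are
  multiples of the same \<open>h\<close>, so a single equation in \<open>z\<close> remains.\<close>

lemma F_on_curve:
  fixes a b c z :: "'a::field" and \<sigma> :: nat
  defines "h \<equiv> 1 + c * z + b * z ^ (\<sigma> + 1) + a * z ^ (\<sigma>\<^sup>2 + \<sigma> + 1)"
  shows "F1 \<sigma> a b c 1 (z ^ (\<sigma> + 1)) z = h"
    and "F2 \<sigma> a b c 1 (z ^ (\<sigma> + 1)) z = z ^ \<sigma> * h"
    and "F3 \<sigma> 1 (z ^ (\<sigma> + 1)) z = 0"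
  by (simp_all add: F1_def F2_def F3_def h_def power_add power_mult_distrib power2_eq_square
      power_mult algebra_simps)

lemma F_has_zero_iff:
  fixes a b c :: "'a::field"
  assumes "\<sigma> > 0"
  shows "(\<exists>u. u \<noteq> 0 \<and> F \<sigma> a b c u = 0) \<longleftrightarrow> has_root \<sigma> a b c"
proof
  assume "\<exists>u. u \<noteq> 0 \<and> F \<sigma> a b c u = 0"
  then obtain u where u: "u \<noteq> 0" "F \<sigma> a b c u = 0" by blast
  show "has_root \<sigma> a b c"
  proof (cases "a = 0")
    case True
    then show ?thesis using assms by (intro exI[of _ 0]) (simp add: power_0_left)
  next
    case False
    \<comment> \<open>If the first coordinate is 0, then \<open>F3\<close> reduces to
      \<open>z ^ (\<sigma> + 1)\<close>, and once \<open>z = 0\<close>, \<open>F2\<close> reduces to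
      \<open>a * y ^ (\<sigma> + 1)\<close>.\<close>
    have "u $ 1 \<noteq> 0"
    proof
      assume x: "u $ 1 = 0"
      then have z: "u $ 3 = 0"
        using u(2) assms by (auto simp: F_eq_0_iff F3_def power_0_left)
      then have "u $ 2 = 0"
        using x u(2) assms False by (auto simp: F_eq_0_iff F2_def power_0_left)
      then show False using x z u(1) by (simp add: vec_eq_iff forall_3)
    qed
    define v where "v = inverse (u $ 1) *s u"
    have v1: "v $ 1 = 1" using \<open>u $ 1 \<noteq> 0\<close> by (simp add: v_def)
    have Fv: "F \<sigma> a b c v = 0" using u(2) by (simp add: v_def F_scale)
    define z where "z = v $ 3"
    have v2: "v $ 2 = z ^ (\<sigma> + 1)" using Fv v1 by (simp add: F_eq_0_iff F3_def z_def)
    have h: "1 + c * z + b * z ^ (\<sigma> + 1) + a * z ^ (\<sigma>\<^sup>2 + \<sigma> + 1) = 0"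
      using Fv v1 v2 F_on_curve(1)[where z = z] by (simp add: F_eq_0_iff z_def)
    then have "z \<noteq> 0" by auto
    then show ?thesis using h reciprocal_root[of z] by blast
  qed
next
  assume "has_root \<sigma> a b c"
  then obtain x where
    x: "x ^ (\<sigma>\<^sup>2 + \<sigma> + 1) + c * x ^ (\<sigma>\<^sup>2 + \<sigma>) + b * x ^ (\<sigma>\<^sup>2) + a = 0" by blast
  show "\<exists>u. u \<noteq> 0 \<and> F \<sigma> a b c u = 0"
  proof (cases "x = 0")
    case True
    then have "a = 0" using x assms by (simp add: power_0_left)
    then have "F \<sigma> a b c (vector [0, 1, 0]) = 0"
      using assms by (simp add: F_eq_0_iff F1_def F2_def F3_def power_0_left)
    then show ?thesis by (intro exI[of _ "vector [0, 1, 0]"]) (simp add: vec_eq_iff forall_3)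
  next
    case False
    define z where "z = 1 / x"
    have "z \<noteq> 0" "x = 1 / z" using False by (simp_all add: z_def)
    then have "1 + c * z + b * z ^ (\<sigma> + 1) + a * z ^ (\<sigma>\<^sup>2 + \<sigma> + 1) = 0"
      using x reciprocal_root[of z] by blast
    then have "F \<sigma> a b c (vector [1, z ^ (\<sigma> + 1), z]) = 0"
      using F_on_curve[where z = z] by (simp add: F_eq_0_iff)
    then show ?thesis
      by (intro exI[of _ "vector [1, z ^ (\<sigma> + 1), z]"]) (simp add: vec_eq_iff forall_3)
  qed
qed

lemma F_onto:
  fixes a b c :: "'a::{field,finite}"
  assumes add: "\<And>x y :: 'a. (x + y) ^ \<sigma> = x ^ \<sigma> + y ^ \<sigma>"
    and nonzero: "\<And>u. F \<sigma> a b c u = 0 \<Longrightarrow> u = 0"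
  shows "\<exists>u l. u \<noteq> 0 \<and> v = l *s F \<sigma> a b c u"
proof -
  have "\<exists>r. r ^ \<sigma> = s" for s :: 'a
    using power_surj_if_additive[OF add] unfolding surj_def by metis
  then obtain r where r: "r s ^ \<sigma> = s" for s :: 'a by metis
  \<comment> \<open>The first equation is \<open>L\<^sub>1(u) \<bullet> v = 0\<close>. The
    coefficients of the second are \<sigma>-th roots of those in
    \<open>L\<^sub>2(u\<^sup>\<sigma>) \<bullet> v = 0\<close>, so that its \<sigma>-th power is
    that condition.\<close>
  obtain x y z where nz: "(x, y, z) \<noteq> (0, 0, 0)"
    and eq1: "v $ 3 * x + (v $ 1 + b * v $ 3) * y + (- (v $ 2)) * z = 0" (is "?e1 = 0")
    and eq: "r (- (v $ 2 + c * v $ 3)) * x + r (- (a * v $ 3)) * y + r (v $ 1) * z = 0"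
    by (rule exists_common_orthogonal_3)
  define u :: "'a ^ 3" where "u = vector [x, y, z]"
  have u0: "u \<noteq> 0" using nz by (auto simp: u_def vec_eq_iff forall_3)
  define X Y Z where XYZ: "X = x ^ \<sigma>" "Y = y ^ \<sigma>" "Z = z ^ \<sigma>"
  \<comment> \<open>For \<open>\<sigma> = 0\<close>, additivity at 0 would read 1 = 1 + 1.\<close>
  have "0 < \<sigma>"
    using add[of 0 0] by (metis add_0 add_cancel_right_left gr0I power_0 zero_neq_one)
  then have "(r (- (v $ 2 + c * v $ 3)) * x + r (- (a * v $ 3)) * y + r (v $ 1) * z) ^ \<sigma> = 0"
    unfolding eq by simp
  then have eq2: "- (v $ 2 + c * v $ 3) * X + - (a * v $ 3) * Y + v $ 1 * Z = 0" (is "?e2 = 0")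
    unfolding add power_mult_distrib r XYZ .
  have F: "F \<sigma> a b c u $ 1 = X * x + a * Y * z + b * X * y + c * X * z"
    "F \<sigma> a b c u $ 2 = a * Y * y + Z * x + b * Z * y + c * X * y"
    "F \<sigma> a b c u $ 3 = Z * z - X * y"
    by (simp_all add: F_def F1_def F2_def F3_def u_def XYZ algebra_simps)
  have "F \<sigma> a b c u \<noteq> 0" using nonzero u0 by blast
  \<comment> \<open>\<open>(L\<^sub>1 \<times> L\<^sub>2) \<times> v = L\<^sub>2 (L\<^sub>1 \<bullet> v) - L\<^sub>1 (L\<^sub>2 \<bullet> v)\<close>\<close>
  then obtain l where "v = l *s F \<sigma> a b c u"
  proof (rule proportional_if_cross_zero)
    have "F \<sigma> a b c u $ 2 * v $ 3 - F \<sigma> a b c u $ 3 * v $ 2 = Z * ?e1 - y * ?e2"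
      unfolding F by (simp add: algebra_simps)
    then show "F \<sigma> a b c u $ 2 * v $ 3 = F \<sigma> a b c u $ 3 * v $ 2" unfolding eq1 eq2 by simp
    have "F \<sigma> a b c u $ 3 * v $ 1 - F \<sigma> a b c u $ 1 * v $ 3 = - X * ?e1 + z * ?e2"
      unfolding F by (simp add: algebra_simps)
    then show "F \<sigma> a b c u $ 3 * v $ 1 = F \<sigma> a b c u $ 1 * v $ 3" unfolding eq1 eq2 by simp
    have "F \<sigma> a b c u $ 1 * v $ 2 - F \<sigma> a b c u $ 2 * v $ 1 = - (a * Y + c * X) * ?e1 - (x + b * y) * ?e2"
      unfolding F by (simp add: algebra_simps)
    then show "F \<sigma> a b c u $ 1 * v $ 2 = F \<sigma> a b c u $ 2 * v $ 1" unfolding eq1 eq2 by simp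
  qed
  then show ?thesis using u0 by blast
qed

theorem theorem1p9:
  fixes a b c :: "'a::{field,finite}"
    and p m k \<sigma> :: nat
  assumes "prime p"
    and "CARD('a) = p ^ m"
    and "\<sigma> = p ^ k"
  shows "induces_proj_bijection (F \<sigma> a b c) \<longleftrightarrow>
    \<not> (\<exists>x :: 'a. x ^ (\<sigma>\<^sup>2 + \<sigma> + 1) + c * x ^ (\<sigma>\<^sup>2 + \<sigma>) + b * x ^ (\<sigma>\<^sup>2) + a = 0)"
proof -
  have "CHAR('a) = p" using assms(1,2) by (rule prime_CHAR_of_CARD)
  then have add: "(x + y) ^ \<sigma> = x ^ \<sigma> + y ^ \<sigma>" for x y :: 'a
    using freshmans_dream' assms(1,3) by blast
  have "\<sigma> > 0" using assms(1,3) by (simp add: prime_gt_0_nat)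
  then have zero_iff: "(\<exists>u. u \<noteq> 0 \<and> F \<sigma> a b c u = 0) \<longleftrightarrow> has_root \<sigma> a b c"
    by (rule F_has_zero_iff)
  have "induces_proj_bijection (F \<sigma> a b c) \<longleftrightarrow> (\<forall>u. F \<sigma> a b c u = 0 \<longrightarrow> u = 0)"
  proof
    assume "\<forall>u. F \<sigma> a b c u = 0 \<longrightarrow> u = 0"
    then have nz: "\<And>u. F \<sigma> a b c u = 0 \<Longrightarrow> u = 0" by blast
    show "induces_proj_bijection (F \<sigma> a b c)"
      by (rule induces_proj_bijection_if_onto[OF nz F_scale F_onto[OF add nz]])
  qed (simp add: induces_proj_bijection_def)
  then show ?thesis using zero_iff by blast
qed

end
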